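(* Assume $\mathrm{cov}(\mathcal{M})=\mathfrak{c}$. Then every filter on $\omega$ of character smaller than $\mathfrak{c}$ can be extended to a Michael ultrafilter.
   Context: $\mathfrak{c}=2^{\aleph_0}$, and $\mathrm{cov}(\mathcal{M})$ is the least number of meager sets needed to cover the real line. All filters on $\omega$ are assumed to be proper and non-principal, in the sense that they contain every cofinite subset of $\omega$. The character of a filter $\mathscr{F}$ is the least cardinality of a basis of $\mathscr{F}$, i.e. of a set $B\subseteq\mathscr{F}$ such that every $F\in\mathscr{F}$ contains some member of $B$. For an ultrafilter $\mathscr{U}$ on $\omega$ and $f,g\in\omega^\omega$, $f\leq_{\mathscr{U}} g$ means $\{n\in\omega : f(n)\leq g(n)\}\in\mathscr{U}$. For $K\subseteq\omega^\omega$, $\mathrm{cof}(K/\mathscr{U})$ is the least cardinality of a set $D\subseteq K$ such that for every $f\in K$ there is $g\in D$ with $f\leq_{\mathscr{U}} g$. $\mathscr{U}$ is a Michael ultrafilter if for every compact $K\subseteq\omega^\omega$, if $\mathrm{cof}(K/\mathscr{U})>\omega$ then $\mathrm{cof}(K/\mathscr{U})\geq\mathrm{cof}(\omega^\omega/\mathscr{U})$. *)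

theory Defs
  imports "HOL-Analysis.Analysis"
begin

unbundle cardinal_syntax

text \<open>
  Cardinal numbers are represented by the cardinal order relations of
  \<^theory>\<open>HOL.BNF_Cardinal_Order_Relation\<close>, compared by \<open>\<le>o\<close>, \<open><o\<close> and \<open>=o\<close>.
\<close>

text \<open>The least cardinality of a member of \<open>S\<close>; meaningful for nonempty \<open>S\<close> only.\<close>

definition least_card :: "'a set set \<Rightarrow> 'a rel" where
  "least_card S = |SOME A. A \<in> S \<and> (\<forall>B\<in>S. |A| \<le>o |B| )|"

lemma least_card:
  assumes "S \<noteq> {}"
  shows "\<exists>A\<in>S. least_card S = |A|" and "\<And>B. B \<in> S \<Longrightarrow> least_card S \<le>o |B|"
proof -
  have "\<exists>r \<in> card_of ` S. \<forall>r' \<in> card_of ` S. r \<le>o r'"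
    using assms by (intro exists_minim_Card_order) (auto simp: card_of_Card_order)
  then have "\<exists>A. A \<in> S \<and> (\<forall>B\<in>S. |A| \<le>o |B| )"
    by auto
  from someI_ex[OF this]
  show "\<exists>A\<in>S. least_card S = |A|" and "\<And>B. B \<in> S \<Longrightarrow> least_card S \<le>o |B|"
    unfolding least_card_def by auto
qed

abbreviation continuum :: "(nat \<Rightarrow> bool) rel" where
  "continuum \<equiv> ctwo ^c natLeq"

definition nowhere_dense :: "'a::topological_space set \<Rightarrow> bool" where
  "nowhere_dense A \<longleftrightarrow> interior (closure A) = {}"

definition meager :: "'a::topological_space set \<Rightarrow> bool" where
  "meager A \<longleftrightarrow> (\<exists>\<N>. countable \<N> \<and> (\<forall>N\<in>\<N>. nowhere_dense N) \<and> A = \<Union>\<N>)"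

definition cov_meager :: "real set rel" where
  "cov_meager = least_card {\<C>. (\<forall>M\<in>\<C>. meager M) \<and> \<Union>\<C> = UNIV}"

text \<open>
  Filters on \<open>\<omega>\<close> are values of type \<^typ>\<open>nat filter\<close>, which includes the improper filter
  \<^term>\<open>bot\<close>. The order is reversed with respect to inclusion of the families of member
  sets: \<open>U \<le> F\<close> means that \<open>U\<close> extends \<open>F\<close>, and \<open>F \<le> cofinite\<close> means that \<open>F\<close> contains every
  cofinite set.
\<close>

definition filter_sets :: "'a filter \<Rightarrow> 'a set set" where
  "filter_sets F = {A. eventually (\<lambda>x. x \<in> A) F}"

definition proper_nonprincipal :: "nat filter \<Rightarrow> bool" where
  "proper_nonprincipal F \<longleftrightarrow> F \<noteq> bot \<and> F \<le> cofinite"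

definition filter_character :: "nat filter \<Rightarrow> nat set rel" where
  "filter_character F =
     least_card {\<B>. \<B> \<subseteq> filter_sets F \<and> (\<forall>A\<in>filter_sets F. \<exists>B\<in>\<B>. B \<subseteq> A)}"

definition ultrafilter :: "nat filter \<Rightarrow> bool" where
  "ultrafilter U \<longleftrightarrow>
     proper_nonprincipal U \<and> (\<forall>A. A \<in> filter_sets U \<or> - A \<in> filter_sets U)"

definition cof_mod :: "(nat \<Rightarrow> nat) set \<Rightarrow> nat filter \<Rightarrow> (nat \<Rightarrow> nat) rel" where
  "cof_mod K U =
     least_card {D. D \<subseteq> K \<and> (\<forall>f\<in>K. \<exists>g\<in>D. eventually (\<lambda>n. f n \<le> g n) U)}"

text \<open>
  \<^const>\<open>compact\<close> refers to the product topology on \<^typ>\<open>nat \<Rightarrow> nat\<close> with discrete factors,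
  i.e. to the Baire space.
\<close>

definition michael_ultrafilter :: "nat filter \<Rightarrow> bool" where
  "michael_ultrafilter U \<longleftrightarrow>
     ultrafilter U \<and>
     (\<forall>K. compact K \<longrightarrow> natLeq <o cof_mod K U \<longrightarrow> cof_mod UNIV U \<le>o cof_mod K U)"

end

theory Submission
  imports Defs "HOL-Algebra.Free_Abelian_Groups"
begin

text \<open>
  Call \<open>K\<close> countably dominated modulo a filter \<open>F\<close> if some countable subset \<open>C\<close> of \<open>K\<close> has the
  property that every \<open>f \<in> K\<close> lies, on a set of \<open>F\<close>, below the pointwise maximum of finitely many
  members of \<open>C\<close>. An ultrafilter extending \<open>F\<close> chooses one of the finitely many, so then \<open>K\<close> has
  countable cofinality modulo it. The ultrafilter \<open>U\<close> is built so that for every closed \<open>K\<close> that is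
  not countably dominated modulo \<open>U\<close> and every \<open>\<gamma>\<close>, the elements of \<open>K\<close> up to \<open>\<gamma>\<close>, in one fixed
  well-order of \<open>\<omega>\<^sup>\<omega>\<close> of type \<open>\<cc>\<close>, have a strict upper bound modulo \<open>U\<close> that belongs to \<open>K\<close>.

  This suffices. The property applies to \<open>\<omega>\<^sup>\<omega>\<close> itself, since a diagonal function escapes every
  countable set; let \<open>h \<gamma>\<close> bound everything up to \<open>\<gamma>\<close>. If \<open>K\<close> has uncountable cofinality and \<open>D\<close>
  is cofinal in \<open>K\<close>, then \<open>D\<close> is also cofinal in the well-order: for each \<open>g\<close> some
  \<open>f \<in> K\<close> is strictly above all elements of \<open>K\<close> up to \<open>g\<close>, so the element of \<open>D\<close> above \<open>f\<close>
  comes after \<open>g\<close>. Hence \<open>h ` D\<close> is cofinal in \<open>\<omega>\<^sup>\<omega>\<close>, and it is no larger than \<open>D\<close>. Comparing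
  with positions in the well-order, rather than counting, lets the argument work for singular
  \<open>\<cc>\<close> as well.

  The bounds are added in a recursion of length \<open>\<cc>\<close>. At each stage the filter is generated by fewer
  than \<open>\<cc>\<close> sets, and a function \<open>f\<close> in a prescribed closed set \<open>K\<close> has to be found that can be put
  strictly above fewer than \<open>\<cc>\<close> given functions (\<open>extension_strictly_above\<close>). Remove from \<open>K\<close> all
  basic open sets in which it is countably dominated by given functions. If \<open>K\<close> as a whole is not
  so dominated, a nonempty closed set \<open>K0\<close> remains that is not dominated in any open set meeting
  it, so that each single requirement on \<open>f\<close> defines a dense open subset of \<open>K0\<close>. Fewer than \<open>cov(M)\<close> dense open sets of a closed
  subset of \<open>\<omega>\<^sup>\<omega>\<close> have a common point (\<open>closed_Int_dense_open_nonempty\<close>). If \<open>K\<close> is countably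
  dominated at its stage, it remains so modulo every extension of the filter, and nothing has to be
  done for it. All promises made along the way persist to extensions, so any ultrafilter extending
  the limit of the recursion will do.
\<close>

section \<open>Generic sequences from the covering number of the meager ideal\<close>

lemma nowhere_denseI:
  assumes "\<And>V. open V \<Longrightarrow> V \<noteq> {} \<Longrightarrow> \<exists>W. open W \<and> W \<noteq> {} \<and> W \<subseteq> V \<and> W \<inter> A = {}"
  shows "nowhere_dense A"
proof (rule ccontr)
  assume "\<not> nowhere_dense A"
  then have "interior (closure A) \<noteq> {}"
    by (simp add: nowhere_dense_def)
  from assms[OF open_interior this] obtain W
    where "open W" "W \<noteq> {}" "W \<subseteq> interior (closure A)" "W \<inter> A = {}"
    by blast
  then show False
    using open_Int_closure_eq_empty[of W A] interior_subset[of "closure A"] by blast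
qed

text \<open>
  A real number directs a descent through a countable preorder enumerated by \<open>e\<close>: whenever the
  binary expansion of \<open>x\<close> shows a digit \<open>1\<close>, the number of zeros between it and the preceding \<open>1\<close>
  names an element, and the walk moves there if that is a step down. If the digits
  read so far form the odd integer \<open>k \<noteq> 1\<close>, this number of zeros is \<open>multiplicity 2 (k - 1) - 1\<close>. Counting
  zeros in this way leaves every element available as the next instruction after any finite
  sequence of digits.
\<close>

primrec walk :: "(nat \<Rightarrow> 'p::preorder) \<Rightarrow> real \<Rightarrow> nat \<Rightarrow> 'p" where
  "walk e x 0 = e 0"
| "walk e x (Suc n) =
    (let k = \<lfloor>2 ^ n * x\<rfloor>; q = e (multiplicity 2 (k - 1) - 1)
     in if odd k \<and> q \<le> walk e x n then q else walk e x n)"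

lemma walk_decreasing: "walk e x (Suc n) \<le> walk e x n"
  by (auto simp: Let_def)

lemma walk_in_range: "walk e x n \<in> range e"
  by (induction n) (auto simp: Let_def)

lemma floor_dyadic_coarsen:
  fixes x :: real
  assumes "i \<le> N"
  shows "\<lfloor>2 ^ i * x\<rfloor> = \<lfloor>2 ^ N * x\<rfloor> div 2 ^ (N - i)"
proof -
  have "2 ^ i * x = (2 ^ N * x) / real_of_int (2 ^ (N - i))"
    using power_add[of "2::real" i "N - i"] assms by (simp add: field_simps)
  then show ?thesis
    using floor_divide_real_eq_div[of "2 ^ (N - i)" "2 ^ N * x"] by simp
qed

lemma walk_cong:
  assumes "\<lfloor>2 ^ N * x\<rfloor> = \<lfloor>2 ^ N * y\<rfloor>" and "n \<le> Suc N"
  shows "walk e x n = walk e y n"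
  using assms(2)
proof (induction n)
  case (Suc n)
  then have "\<lfloor>2 ^ n * x\<rfloor> = \<lfloor>2 ^ n * y\<rfloor>"
    using assms(1) by (simp add: floor_dyadic_coarsen[of n N])
  with Suc show ?case by (simp add: Let_def)
qed simp

lemma dyadic_interval_in_open:
  fixes V :: "real set"
  assumes "open V" "V \<noteq> {}"
  obtains n k where "{x. \<lfloor>2 ^ n * x\<rfloor> = k} \<subseteq> V"
proof -
  obtain x0 where "x0 \<in> V" using assms by blast
  then obtain d where d: "d > 0" "ball x0 d \<subseteq> V"
    using assms open_contains_ball by blast
  obtain n where n: "(1/2::real) ^ n < d"
    using d(1) real_arch_pow_inv[of d "1/2"] by auto
  have "x \<in> V" if "\<lfloor>2 ^ n * x\<rfloor> = \<lfloor>2 ^ n * x0\<rfloor>" for x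
  proof -
    have "\<bar>2 ^ n * x - 2 ^ n * x0\<bar> < 1"
      using that by linarith
    then have "2 ^ n * \<bar>x - x0\<bar> < 1"
      by (simp add: abs_mult flip: right_diff_distrib)
    then have "\<bar>x - x0\<bar> < (1/2) ^ n"
      by (simp add: field_simps power_divide)
    then show ?thesis
      using n d(2) by (auto simp: subset_eq dist_real_def)
  qed
  then show ?thesis by (intro that[of n "\<lfloor>2 ^ n * x0\<rfloor>"]) blast
qed

text \<open>
  Inside every open set there is a dyadic interval, whose digits have led the walk to some \<open>p\<close>. By
  density there is an element of \<open>E\<close> below \<open>p\<close>; the digits that name it determine a smaller dyadic
  interval, on which the walk enters \<open>E\<close>.
\<close>

lemma nowhere_dense_walk_misses:
  assumes dense: "\<And>p. p \<in> range e \<Longrightarrow> \<exists>q\<in>range e \<inter> E. q \<le> p"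
  shows "nowhere_dense {x. \<forall>n. walk e x n \<notin> E}"
proof (rule nowhere_denseI)
  fix V :: "real set"
  assume "open V" "V \<noteq> {}"
  then obtain n k where V: "{x. \<lfloor>2 ^ n * x\<rfloor> = k} \<subseteq> V"
    using dyadic_interval_in_open by blast
  \<comment> \<open>The extra digit \<open>1\<close> of \<open>j\<close> fixes where the block of zeros written next begins. It may itself move
  the walk, so the position \<open>p\<close> is read off after it; any point with the digits \<open>j\<close> serves for that.\<close>
  define j where "j = 2 * k + 1"
  define p where "p = walk e (of_int j / 2 ^ (n + 1)) (n + 2)"
  obtain m where m: "e m \<in> E" "e m \<le> p"
    using dense[of p] walk_in_range[of e _ "n + 2"] unfolding p_def by blast
  define N where "N = n + m + 2"
  \<comment> \<open>The digits of \<open>j\<close>, then \<open>m\<close> zeros, then a \<open>1\<close>: the instruction to go to \<open>e m\<close>.\<close>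
  define l where "l = j * 2 ^ (m + 1) + 1"
  define W where "W = {x::real. l < 2 ^ N * x \<and> 2 ^ N * x < l + 1}"
  have fl: "\<lfloor>2 ^ (n + 1 + i) * x\<rfloor> = j * 2 ^ i" if "x \<in> W" "i \<le> m" for x i
  proof -
    have "\<lfloor>2 ^ (n + 1 + i) * x\<rfloor> = l div 2 ^ (m + 1 - i)"
    proof -
      have "\<lfloor>2 ^ N * x\<rfloor> = l" using \<open>x \<in> W\<close> by (simp add: W_def floor_unique)
      moreover have "N - (n + 1 + i) = m + 1 - i" using that by (simp add: N_def)
      ultimately show ?thesis using that floor_dyadic_coarsen[of "n + 1 + i" N x] by (simp add: N_def)
    qed
    also have "l = 1 + j * 2 ^ i * 2 ^ (m + 1 - i)"
      using that by (simp add: l_def flip: power_add)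
    also have "\<dots> div 2 ^ (m + 1 - i) = j * 2 ^ i"
    proof -
      have "(1::int) < 2 ^ (m + 1 - i)" using that by (intro one_less_power) auto
      then have "(1 + c * 2 ^ (m + 1 - i)) div 2 ^ (m + 1 - i) = c" for c :: int
        by (subst div_mult_self1) auto
      then show ?thesis by blast
    qed
    finally show ?thesis .
  qed
  have "open W"
    unfolding W_def by (intro open_Collect_conj open_Collect_less continuous_intros)
  moreover have "W \<noteq> {}"
  proof -
    have "(l + 1/2) / 2 ^ N \<in> W"
      unfolding W_def by simp
    then show ?thesis by blast
  qed
  moreover have "W \<subseteq> V"
  proof
    fix x assume "x \<in> W"
    have "\<lfloor>2 ^ n * x\<rfloor> = k"
      using floor_dyadic_coarsen[of n "n + 1" x] fl[OF \<open>x \<in> W\<close>, of 0] by (simp add: j_def)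
    then show "x \<in> V" using V by blast
  qed
  moreover have "W \<inter> {x. \<forall>n. walk e x n \<notin> E} = {}"
  proof -
    have "walk e x (N + 1) \<in> E" if "x \<in> W" for x
    proof -
      have "walk e x (n + 2 + i) = p" if "i \<le> m" for i
        using that
      proof (induction i)
        case 0
        have "\<lfloor>2 ^ (n + 1) * x\<rfloor> = j"
          using fl[OF \<open>x \<in> W\<close>, of 0] by simp
        moreover have "2 ^ (n + 1) * (real_of_int j / 2 ^ (n + 1)) = j"
          by simp
        ultimately have "\<lfloor>2 ^ (n + 1) * x\<rfloor> = \<lfloor>2 ^ (n + 1) * (real_of_int j / 2 ^ (n + 1))\<rfloor>"
          by (simp only: floor_of_int)
        then show ?case
          unfolding p_def add_0_right by (rule walk_cong) simp
      next
        case (Suc i)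
        have "even \<lfloor>2 ^ (n + 2 + i) * x\<rfloor>"
          using fl[OF \<open>x \<in> W\<close> Suc.prems] by simp
        then show ?case using Suc by (simp add: Let_def)
      qed
      then have p: "walk e x N = p" by (simp add: N_def)
      have l: "\<lfloor>2 ^ N * x\<rfloor> = l" using \<open>x \<in> W\<close> by (simp add: W_def floor_unique)
      have "odd j" by (simp add: j_def)
      then have "multiplicity 2 (l - 1) = multiplicity 2 ((2::int) ^ (m + 1))"
        unfolding l_def add_diff_cancel_right'
        by (intro multiplicity_prime_elem_times_other prime_imp_prime_elem two_is_prime)
      also have "\<dots> = m + 1"
        by (intro multiplicity_same_power) auto
      finally have "multiplicity 2 (l - 1) = m + 1" .
      moreover have "odd l" by (simp add: l_def)
      ultimately show ?thesis using p l m by (simp add: Let_def)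
    qed
    then show ?thesis
      by blast
  qed
  ultimately show "\<exists>W. open W \<and> W \<noteq> {} \<and> W \<subseteq> V \<and> W \<inter> {x. \<forall>n. walk e x n \<notin> E} = {}"
    by (intro exI[of _ W]) simp
qed

lemma cov_meager_le_card:
  fixes \<C> :: "real set set"
  assumes "\<And>M. M \<in> \<C> \<Longrightarrow> meager M" "\<Union>\<C> = UNIV"
  shows "cov_meager \<le>o |\<C>|"
proof -
  have *: "\<C> \<in> {\<C>. (\<forall>M\<in>\<C>. meager M) \<and> \<Union>\<C> = UNIV}"
    using assms by simp
  show ?thesis
    unfolding cov_meager_def by (rule least_card(2)[OF _ *]) (use * in blast)
qed

text \<open>
  If every real directed the walk past one of the dense sets \<open>E i m\<close>, grouping the reals by \<open>i\<close>
  would give a cover of the line by at most \<open>|I|\<close> meager sets. This is Martin's axiom for countable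
  orders and fewer than \<open>cov(M)\<close> dense sets, with countably many of them grouped under each index.
\<close>

lemma generic_sequence_cov_meager:
  fixes P :: "'p::preorder set" and E :: "'i \<Rightarrow> nat \<Rightarrow> 'p set"
  assumes "countable P" "P \<noteq> {}" and I: "|I| <o cov_meager"
    and dense: "\<And>i m p. i \<in> I \<Longrightarrow> p \<in> P \<Longrightarrow> \<exists>q\<in>P \<inter> E i m. q \<le> p"
  obtains s :: "nat \<Rightarrow> 'p"
    where "range s \<subseteq> P" "\<And>n. s (Suc n) \<le> s n" "\<And>i m. i \<in> I \<Longrightarrow> \<exists>n. s n \<in> E i m"
proof -
  define e where "e = from_nat_into P"
  have e: "range e = P" unfolding e_def using assms(1,2) by (rule range_from_nat_into[rotated])
  define miss where "miss i m = {x. \<forall>n. walk e x n \<notin> E i m}" for i m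
  have nd: "nowhere_dense (miss i m)" if "i \<in> I" for i m
    unfolding miss_def using dense[OF that] by (intro nowhere_dense_walk_misses) (simp add: e)
  let ?\<C> = "(\<lambda>i. \<Union>m. miss i m) ` I"
  have "meager M" if M: "M \<in> ?\<C>" for M
  proof -
    obtain i where i: "i \<in> I" "M = \<Union>(range (miss i))"
      using M by blast
    then show ?thesis
      unfolding meager_def using i nd by (intro exI[of _ "range (miss i)"]) auto
  qed
  moreover have "|?\<C>| <o cov_meager"
    using card_of_image I by (rule ordLeq_ordLess_trans)
  ultimately have "\<Union>?\<C> \<noteq> UNIV"
    using cov_meager_le_card not_ordLeq_ordLess by blast
  then obtain x where "x \<notin> \<Union>?\<C>" by blast
  then have "\<exists>n. walk e x n \<in> E i m" if "i \<in> I" for i m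
    using that by (auto simp: miss_def)
  then show ?thesis
    using walk_in_range walk_decreasing e by (intro that[of "walk e x"]) blast+
qed

section \<open>Dense open subsets of closed sets in the Baire space\<close>

definition cylinder :: "(nat \<Rightarrow> nat) \<Rightarrow> nat \<Rightarrow> (nat \<Rightarrow> nat) set" where
  "cylinder f n = {g. \<forall>i<n. g i = f i}"

lemma open_cylinder: "open (cylinder f n)"
proof -
  have "cylinder f n = (\<Inter>i\<in>{..<n}. (\<lambda>g. g i) -` {f i})"
    by (auto simp: cylinder_def)
  also have "open \<dots>"
    by (intro open_INT ballI open_vimage continuous_on_product_coordinates open_discrete) auto
  finally show ?thesis .
qed

lemma open_contains_cylinder:
  assumes "open V" "f \<in> V"
  obtains n where "cylinder f n \<subseteq> V"
proof -
  have "openin (product_topology (\<lambda>i. euclidean) UNIV) V"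
    using assms(1) by (simp add: open_fun_def)
  from product_topology_open_contains_basis[OF this assms(2)]
  obtain X where X: "f \<in> (\<Pi>\<^sub>E i\<in>UNIV. X i)" "finite {i. X i \<noteq> UNIV}" "(\<Pi>\<^sub>E i\<in>UNIV. X i) \<subseteq> V"
    by auto
  from X(2) obtain n where n: "\<And>i. X i \<noteq> UNIV \<Longrightarrow> i < n"
    unfolding finite_nat_iff_bounded by blast
  have "g \<in> (\<Pi>\<^sub>E i\<in>UNIV. X i)" if "g \<in> cylinder f n" for g
  proof (rule PiE_I)
    fix i
    show "g i \<in> X i"
      using n[of i] that X(1) by (cases "X i = UNIV") (auto simp: cylinder_def PiE_iff)
  qed simp
  with X(3) show ?thesis by (intro that[of n]) blast
qed

lemma countable_cylinders: "countable {cylinder f n | f n. f \<in> K}"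
proof (rule countable_subset)
  show "countable (range (\<lambda>l. {g :: nat \<Rightarrow> nat. \<forall>i<length l. g i = l ! i}))"
    by simp
  have "cylinder f n = {g. \<forall>i<length (map f [0..<n]). g i = map f [0..<n] ! i}" for f n
    by (auto simp: cylinder_def)
  then show "{cylinder f n | f n. f \<in> K} \<subseteq> range (\<lambda>l. {g. \<forall>i<length l. g i = l ! i})"
    by blast
qed

text \<open>
  The generic sequence is taken in the order of cylinders that meet \<open>K\<close>. It is required to enter
  each of the given open sets and to reach every length; its limit then belongs to all the open
  sets, and to \<open>K\<close> because \<open>K\<close> is closed. Isolated points of \<open>K\<close> cause no trouble, as they belong
  to every dense set.
\<close>

lemma closed_Int_dense_open_nonempty:
  fixes K :: "(nat \<Rightarrow> nat) set"
  assumes K: "closed K" "K \<noteq> {}" and \<O>: "|\<O>| <o cov_meager"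
    and op: "\<And>D. D \<in> \<O> \<Longrightarrow> open D"
    and dense: "\<And>D V. D \<in> \<O> \<Longrightarrow> open V \<Longrightarrow> V \<inter> K \<noteq> {} \<Longrightarrow> V \<inter> K \<inter> D \<noteq> {}"
  shows "K \<inter> \<Inter>\<O> \<noteq> {}"
proof (cases "\<O> = {}")
  case False
  define P where "P = {cylinder f n | f n. f \<in> K}"
  define E where "E D m = {p. \<exists>f n. m \<le> n \<and> p = cylinder f n \<and> p \<subseteq> D}" for D m
  have "countable P"
    unfolding P_def by (rule countable_cylinders)
  have "P \<noteq> {}"
    using K(2) by (auto simp: P_def)
  have refine: "\<exists>q\<in>P \<inter> E D m. q \<le> p" if D: "D \<in> \<O>" and p: "p \<in> P" for D m p
  proof -
    have "open p" "p \<inter> K \<noteq> {}"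
      using p open_cylinder by (auto simp: P_def cylinder_def)
    then obtain h where h: "h \<in> p" "h \<in> K" "h \<in> D"
      using dense[OF D] by blast
    moreover have "open (p \<inter> D)"
      using \<open>open p\<close> op[OF D] by (rule open_Int)
    ultimately obtain k where k: "cylinder h k \<subseteq> p \<inter> D"
      using open_contains_cylinder[of "p \<inter> D" h] by blast
    have "cylinder h (max k m) \<subseteq> cylinder h k"
      by (auto simp: cylinder_def)
    with k have "cylinder h (max k m) \<subseteq> p" "cylinder h (max k m) \<subseteq> D"
      by auto
    moreover have "cylinder h (max k m) \<in> P"
      using h(2) by (auto simp: P_def)
    moreover have "cylinder h (max k m) \<in> E D m"
      unfolding E_def using \<open>cylinder h (max k m) \<subseteq> D\<close> max.cobounded2[of m k] by blast
    ultimately show ?thesis by blast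
  qed
  obtain s where s: "range s \<subseteq> P" "\<And>n. s (Suc n) \<le> s n"
    and hit: "\<And>D m. D \<in> \<O> \<Longrightarrow> \<exists>n. s n \<in> E D m"
    by (rule generic_sequence_cov_meager[OF \<open>countable P\<close> \<open>P \<noteq> {}\<close> \<O>, where E = E])
      (use refine in blast)+
  have antimono: "s n \<subseteq> s m" if "m \<le> n" for m n
    using lift_Suc_antimono_le[of s, OF s(2) that] .
  have "\<exists>g. g \<in> s n \<inter> K" for n
  proof -
    have "s n \<in> P" using s(1) by blast
    then show ?thesis by (auto simp: P_def cylinder_def)
  qed
  then obtain t where t: "\<And>n. t n \<in> s n" "\<And>n. t n \<in> K"
    by (metis IntE)
  have "\<exists>n. \<forall>f\<in>s n. \<forall>g\<in>s n. \<forall>i<m. f i = g i" for m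
  proof -
    obtain D where "D \<in> \<O>" using False by blast
    then obtain n where "s n \<in> E D m" using hit by blast
    then show ?thesis
      by (intro exI[of _ n]) (auto simp: E_def cylinder_def)
  qed
  then obtain N where N: "\<And>m f g i. f \<in> s (N m) \<Longrightarrow> g \<in> s (N m) \<Longrightarrow> i < m \<Longrightarrow> f i = g i"
    by metis
  define a where "a i = t (N (Suc i)) i" for i
  have a: "t k i = a i" if "N (Suc i) \<le> k" for k i
  proof -
    have "t k \<in> s (N (Suc i))"
      using antimono[OF that] t(1)[of k] by (rule subsetD)
    then show ?thesis
      unfolding a_def using t(1) by (rule N) simp
  qed
  \<comment> \<open>For large \<open>k\<close> both \<open>t k \<in> s n\<close> and \<open>t k i = a i\<close>.\<close>
  have agree: "a i = f i" if f: "f \<in> s n" and const: "\<And>g. g \<in> s n \<Longrightarrow> g i = f i" for f n i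
  proof -
    have "t (max n (N (Suc i))) \<in> s n"
      using t(1) antimono[of n "max n (N (Suc i))"] by auto
    then show ?thesis
      using const a[of i "max n (N (Suc i))"] by force
  qed
  have "a \<in> D" if D: "D \<in> \<O>" for D
  proof -
    obtain n f j where s_n: "s n = cylinder f j" "s n \<subseteq> D"
      using hit[OF D, of 0] by (auto simp: E_def)
    have "a i = f i" if "i < j" for i
      using that by (intro agree[of f n]) (auto simp: s_n cylinder_def)
    with s_n show ?thesis
      by (auto simp: cylinder_def)
  qed
  moreover have "a \<in> K"
  proof (rule ccontr)
    assume "a \<notin> K"
    then obtain m where m: "cylinder a m \<subseteq> - K"
      using open_contains_cylinder[of "- K" a] K(1) by blast
    have "a i = t (N m) i" if "i < m" for i
      using that t(1) N by (intro agree[of "t (N m)" "N m"]) auto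
    then have "t (N m) \<in> cylinder a m"
      by (simp add: cylinder_def)
    with m t(2) show False by blast
  qed
  ultimately show ?thesis by blast
qed (use K in auto)

section \<open>Countable domination modulo a filter\<close>

text \<open>
  Domination by finitely many functions at once is the form that survives before the filter is an
  ultrafilter. The countable set is taken inside a set \<open>G\<close>, which at a stage of the recursion
  consists of the elements of \<open>K\<close> met so far.
\<close>

definition countably_dominated :: "(nat \<Rightarrow> nat) set \<Rightarrow> nat filter \<Rightarrow> (nat \<Rightarrow> nat) set \<Rightarrow> bool" where
  "countably_dominated G F K \<longleftrightarrow>
     (\<exists>C\<subseteq>G. countable C \<and>
        (\<forall>f\<in>K. \<exists>C0\<subseteq>C. finite C0 \<and> eventually (\<lambda>n. \<exists>g\<in>C0. f n \<le> g n) F))"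

text \<open>
  Domination persists when the filter grows, which is why a set that is dominated at its stage of the
  recursion needs no attention later.
\<close>

lemma countably_dominated_mono:
  assumes "countably_dominated G F K" "G \<subseteq> G'" "F' \<le> F" "K' \<subseteq> K"
  shows "countably_dominated G' F' K'"
proof -
  obtain C where C: "C \<subseteq> G" "countable C"
    and dom: "\<forall>f\<in>K. \<exists>C0\<subseteq>C. finite C0 \<and> eventually (\<lambda>n. \<exists>g\<in>C0. f n \<le> g n) F"
    using assms(1) unfolding countably_dominated_def by auto
  have "\<exists>C0\<subseteq>C. finite C0 \<and> eventually (\<lambda>n. \<exists>g\<in>C0. f n \<le> g n) F'" if "f \<in> K'" for f
    using dom that assms(4) filter_leD[OF assms(3)] by (meson subsetD)
  then show ?thesis
    unfolding countably_dominated_def using C assms(2) by (intro exI[of _ C]) auto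
qed

lemma countably_dominated_Union:
  assumes "countable \<K>" and dom: "\<And>K. K \<in> \<K> \<Longrightarrow> countably_dominated G F K"
  shows "countably_dominated G F (\<Union>\<K>)"
proof -
  have "\<forall>K\<in>\<K>. \<exists>C. C \<subseteq> G \<and> countable C \<and>
      (\<forall>f\<in>K. \<exists>C0\<subseteq>C. finite C0 \<and> eventually (\<lambda>n. \<exists>g\<in>C0. f n \<le> g n) F)"
    using dom by (simp add: countably_dominated_def)
  then obtain C where C: "\<forall>K\<in>\<K>. C K \<subseteq> G \<and> countable (C K) \<and>
      (\<forall>f\<in>K. \<exists>C0\<subseteq>C K. finite C0 \<and> eventually (\<lambda>n. \<exists>g\<in>C0. f n \<le> g n) F)"
    by (rule bchoice[THEN exE])
  have "\<exists>C0\<subseteq>\<Union>(C ` \<K>). finite C0 \<and> eventually (\<lambda>n. \<exists>g\<in>C0. f n \<le> g n) F" if f: "f \<in> \<Union>\<K>" for f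
  proof -
    obtain K where "K \<in> \<K>" "f \<in> K" using f by blast
    then obtain C0 where "C0 \<subseteq> C K" "finite C0 \<and> eventually (\<lambda>n. \<exists>g\<in>C0. f n \<le> g n) F"
      using C by meson
    moreover have "C K \<subseteq> \<Union>(C ` \<K>)" using \<open>K \<in> \<K>\<close> by blast
    ultimately show ?thesis by (intro exI[of _ C0]) simp
  qed
  moreover have "countable (\<Union>(C ` \<K>))" "\<Union>(C ` \<K>) \<subseteq> G"
    using C \<open>countable \<K>\<close> by auto
  ultimately show ?thesis
    unfolding countably_dominated_def by (intro exI[of _ "\<Union>(C ` \<K>)"]) simp
qed

text \<open>
  Diagonalization: \<open>f\<close> eventually exceeds each member of a given countable set, hence on a cofinite
  set it exceeds any finitely many of them.
\<close>

lemma not_countably_dominated_UNIV: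
  assumes "proper_nonprincipal F"
  shows "\<not> countably_dominated G F UNIV"
proof
  assume "countably_dominated G F UNIV"
  then obtain C where "countable C"
    and C: "\<forall>f :: nat \<Rightarrow> nat. \<exists>C0\<subseteq>C. finite C0 \<and> eventually (\<lambda>n. \<exists>g\<in>C0. f n \<le> g n) F"
    unfolding countably_dominated_def by auto
  \<comment> \<open>For empty \<open>C\<close> the values of \<open>from_nat_into C\<close> are arbitrary, which does no harm here.\<close>
  define f where "f n = Suc (\<Sum>i\<le>n. from_nat_into C i n)" for n
  obtain C0 where C0: "C0 \<subseteq> C" "finite C0" and le: "eventually (\<lambda>n. \<exists>g\<in>C0. f n \<le> g n) F"
    using C by blast
  have "eventually (\<lambda>n. g n < f n) cofinite" if g: "g \<in> C" for g
  proof -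
    obtain i where i: "from_nat_into C i = g"
      using from_nat_into_surj[OF \<open>countable C\<close> g] by blast
    have "g n < f n" if "i \<le> n" for n
      using member_le_sum[of i "{..n}" "\<lambda>i. from_nat_into C i n"] that i by (simp add: f_def)
    then show ?thesis
      unfolding cofinite_eq_sequentially eventually_sequentially by blast
  qed
  then have "eventually (\<lambda>n. \<forall>g\<in>C0. g n < f n) cofinite"
    using C0 by (intro eventually_ball_finite) auto
  then have "eventually (\<lambda>n. \<forall>g\<in>C0. g n < f n) F"
    using assms unfolding proper_nonprincipal_def by (blast intro: filter_leD)
  with le have "eventually (\<lambda>n. False) F"
    by eventually_elim (force simp: not_less)
  then show False
    using assms by (simp add: proper_nonprincipal_def trivial_limit_def)
qed

section \<open>Sets of fewer than continuum many elements\<close>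

lemma card_of_continuum_eq: "continuum =o |UNIV :: (nat \<Rightarrow> bool) set|"
  using card_of_Func_UNIV[where 'a = nat and B = "UNIV :: bool set"]
  by (simp add: cexp_def ctwo_def Field_natLeq Field_card_of)

lemma Card_order_continuum: "Card_order continuum"
  unfolding cexp_def by (rule card_of_Card_order)

lemma infinite_Field_continuum: "infinite (Field continuum)"
proof -
  have "cinfinite continuum"
    by (intro cinfinite_cexp ordLeq_refl Card_order_ctwo natLeq_Cinfinite)
  then show ?thesis by (simp add: cinfinite_def)
qed

lemma card_of_functions_le_continuum: "|UNIV :: (nat \<Rightarrow> nat) set| \<le>o continuum"
proof -
  define graph :: "(nat \<Rightarrow> nat) \<Rightarrow> nat \<Rightarrow> bool"
    where "graph f = (\<lambda>k. f (fst (prod_decode k)) = snd (prod_decode k))" for f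
  have "inj graph"
  proof (rule injI)
    fix f g assume "graph f = graph g"
    then have "graph f (prod_encode (n, f n)) = graph g (prod_encode (n, f n))" for n
      by simp
    then show "f = g"
      by (auto simp: graph_def)
  qed
  then have "|UNIV :: (nat \<Rightarrow> nat) set| \<le>o |UNIV :: (nat \<Rightarrow> bool) set|"
    using card_of_ordLeq by blast
  then show ?thesis
    using card_of_continuum_eq ordIso_symmetric ordLeq_ordIso_trans by blast
qed

lemma card_of_Fpow_less_continuum:
  assumes "|A| <o continuum"
  shows "|Fpow A| <o continuum"
proof (cases "finite A")
  case True
  then have "finite (Fpow A)"
    by (simp add: Fpow_Pow_finite)
  then have "|Fpow A| <o |Field continuum|"
    using infinite_Field_continuum by (rule finite_ordLess_infinite2)
  then show ?thesis
    using card_of_Field_ordIso[OF Card_order_continuum] by (rule ordLess_ordIso_trans)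
next
  case False
  then show ?thesis
    using card_of_Fpow_infinite assms ordIso_ordLess_trans by blast
qed

section \<open>Adding an upper bound to a small filter\<close>

definition strictly_above :: "(nat \<Rightarrow> nat) set \<Rightarrow> (nat \<Rightarrow> nat) \<Rightarrow> nat filter" where
  "strictly_above G f = (INF g\<in>G. principal {n. g n < f n})"

lemma eventually_generated:
  "eventually P (INF A\<in>\<S>. principal A) \<longleftrightarrow> (\<exists>\<T>\<in>Fpow \<S>. \<forall>n\<in>\<Inter>\<T>. P n)"
proof -
  have "eventually P (INF A\<in>\<T>. principal A) \<longleftrightarrow> (\<forall>n\<in>\<Inter>\<T>. P n)" if "finite \<T>" for \<T>
    using INF_principal_finite[OF that, of "\<lambda>A. A"] by (simp add: eventually_principal)
  then show ?thesis
    by (subst eventually_INF) (simp add: Fpow_def Bex_def conj_ac cong: conj_cong)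
qed

lemma generated_by_few_sets:
  assumes "filter_character F <o continuum"
  obtains \<S> where "F = (INF A\<in>\<S>. principal A)" "|\<S>| <o continuum"
proof -
  let ?bases = "{\<B>. \<B> \<subseteq> filter_sets F \<and> (\<forall>A\<in>filter_sets F. \<exists>B\<in>\<B>. B \<subseteq> A)}"
  have "filter_sets F \<in> ?bases" by blast
  then have "?bases \<noteq> {}" by blast
  from least_card(1)[OF this] obtain \<B> where \<B>: "\<B> \<subseteq> filter_sets F"
    "\<forall>A\<in>filter_sets F. \<exists>B\<in>\<B>. B \<subseteq> A" and card: "filter_character F = |\<B>|"
    unfolding filter_character_def by blast
  have "F = (INF A\<in>\<B>. principal A)"
  proof (rule antisym)
    show "F \<le> (INF A\<in>\<B>. principal A)"
      using \<B>(1) by (intro INF_greatest) (auto simp: le_principal filter_sets_def)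
    show "(INF A\<in>\<B>. principal A) \<le> F"
    proof (rule filter_leI)
      fix P assume "eventually P F"
      then have "{x. P x} \<in> filter_sets F" by (simp add: filter_sets_def)
      then obtain B where "B \<in> \<B>" "B \<subseteq> {x. P x}" using \<B>(2) by blast
      then show "eventually P (INF A\<in>\<B>. principal A)"
        by (intro eventually_INF1[of B]) (auto simp: eventually_principal)
    qed
  qed
  then show ?thesis using that card assms by simp
qed

text \<open>
  The set \<open>K0\<close> is what remains of \<open>K\<close> after removing all basic open sets in which \<open>K\<close> is
  countably dominated. As there are only countably many basic open sets, the removed part of \<open>K\<close> is
  countably dominated as a whole. So \<open>K0\<close> is nonempty, and it is not countably dominated in any
  open set \<open>V\<close> that meets it, since otherwise all basic open subsets of \<open>V\<close> would have been
  removed. In particular, for every set of the filter and finitely many members of \<open>G\<close>, some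
  \<open>f \<in> V \<inter> K0\<close> exceeds all of these at some point of that set. These are the dense open conditions
  which make the desired extension proper; there are fewer than continuum many of them.
\<close>

lemma extension_strictly_above:
  assumes cov: "cov_meager =o continuum"
    and \<S>: "|\<S>| <o continuum" and G: "|G| <o continuum"
    and K: "closed K" "\<not> countably_dominated G (INF A\<in>\<S>. principal A) K"
  shows "\<exists>f\<in>K. inf (INF A\<in>\<S>. principal A) (strictly_above G f) \<noteq> bot"
proof -
  define F where "F = (INF A\<in>\<S>. principal A)"
  obtain \<B> :: "(nat \<Rightarrow> nat) set set" where \<B>: "countable \<B>" "topological_basis \<B>"
    using ex_countable_basis by blast
  define \<V> where "\<V> = {V \<in> \<B>. countably_dominated G F (V \<inter> K)}"
  define K0 where "K0 = K - \<Union>\<V>"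
  have rest: "countably_dominated G F (\<Union>\<V> \<inter> K)"
  proof -
    have "countably_dominated G F (\<Union>((\<lambda>V. V \<inter> K) ` \<V>))"
      using \<B>(1) by (intro countably_dominated_Union) (auto simp: \<V>_def)
    then show ?thesis by (rule countably_dominated_mono) auto
  qed
  have undominated: "\<not> countably_dominated G F (V \<inter> K0)" if V: "open V" "V \<inter> K0 \<noteq> {}" for V
  proof
    assume "countably_dominated G F (V \<inter> K0)"
    with rest have "countably_dominated G F (\<Union>{V \<inter> K0, \<Union>\<V> \<inter> K})"
      by (intro countably_dominated_Union) auto
    moreover obtain x where x: "x \<in> V" "x \<in> K0"
      using V(2) by blast
    moreover obtain B where B: "B \<in> \<B>" "x \<in> B" "B \<subseteq> V"
      using topological_basisE[OF \<B>(2) V(1) x(1)] by blast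
    moreover have "B \<inter> K \<subseteq> \<Union>{V \<inter> K0, \<Union>\<V> \<inter> K}"
      using B(3) by (auto simp: K0_def)
    ultimately have "B \<in> \<V>"
      unfolding \<V>_def by (blast intro: countably_dominated_mono)
    then show False
      using B(2) x(2) by (auto simp: K0_def)
  qed
  define D where "D = (\<lambda>(\<T>, C). {f :: nat \<Rightarrow> nat. \<exists>n\<in>\<Inter>\<T>. \<forall>g\<in>C. g n < f n})"
  have "K0 \<inter> \<Inter>(D ` (Fpow \<S> \<times> Fpow G)) \<noteq> {}"
  proof (rule closed_Int_dense_open_nonempty)
    have "open V" if "V \<in> \<V>" for V
      using that \<B>(2) by (auto simp: \<V>_def topological_basis_open)
    then show "closed K0"
      unfolding K0_def using K(1) by (intro closed_Diff open_Union) auto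
    show "K0 \<noteq> {}"
    proof
      assume "K0 = {}"
      then have "K \<subseteq> \<Union>\<V> \<inter> K" by (auto simp: K0_def)
      then show False
        using countably_dominated_mono[OF rest order_refl order_refl] K(2) by (simp add: F_def)
    qed
    have "|Fpow \<S> \<times> Fpow G| <o continuum"
      using \<S> G by (intro card_of_Times_ordLess_infinite_Field infinite_Field_continuum
          Card_order_continuum card_of_Fpow_less_continuum)
    then have "|D ` (Fpow \<S> \<times> Fpow G)| <o continuum"
      by (rule ordLeq_ordLess_trans[OF card_of_image])
    then show "|D ` (Fpow \<S> \<times> Fpow G)| <o cov_meager"
      using ordIso_symmetric[OF cov] by (rule ordLess_ordIso_trans)
    fix E assume "E \<in> D ` (Fpow \<S> \<times> Fpow G)"
    then obtain \<T> C where \<T>: "\<T> \<in> Fpow \<S>" and C: "C \<subseteq> G" "finite C" and E: "E = D (\<T>, C)"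
      by (auto simp: Fpow_def)
    have "E = (\<Union>n\<in>\<Inter>\<T>. \<Inter>g\<in>C. (\<lambda>f. f n) -` {g n<..})"
      unfolding E D_def by auto
    also have "open \<dots>"
      using C(2) by (intro open_UN ballI open_INT open_vimage continuous_on_product_coordinates)
        (auto simp: open_discrete)
    finally show "open E" .
    fix V assume "open V" "V \<inter> K0 \<noteq> {}"
    have "\<exists>f\<in>V \<inter> K0. \<not> eventually (\<lambda>n. \<exists>g\<in>C. f n \<le> g n) F"
    proof (rule ccontr)
      assume "\<not> ?thesis"
      then have "countably_dominated G F (V \<inter> K0)"
        unfolding countably_dominated_def using C
        by (intro exI[of _ C] conjI ballI) (auto simp: countable_finite)
      with undominated[OF \<open>open V\<close> \<open>V \<inter> K0 \<noteq> {}\<close>] show False by blast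
    qed
    then obtain f where "f \<in> V \<inter> K0" and "\<not> eventually (\<lambda>n. \<exists>g\<in>C. f n \<le> g n) F"
      by blast
    then have "\<not> (\<forall>n\<in>\<Inter>\<T>. \<exists>g\<in>C. f n \<le> g n)"
      using \<T> unfolding F_def eventually_generated by blast
    then have "f \<in> E"
      unfolding E D_def by (simp add: not_le)
    with \<open>f \<in> V \<inter> K0\<close> show "V \<inter> K0 \<inter> E \<noteq> {}" by blast
  qed
  then obtain f where "f \<in> K0" and f: "\<And>\<T> C. \<T> \<in> Fpow \<S> \<Longrightarrow> C \<in> Fpow G \<Longrightarrow> f \<in> D (\<T>, C)"
    by blast
  have "inf F (strictly_above G f) \<noteq> bot"
  proof
    assume "inf F (strictly_above G f) = bot"
    then have "eventually (\<lambda>n. False) (inf F (strictly_above G f))" by simp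
    then have "\<exists>Q R. eventually Q F \<and> eventually R (strictly_above G f) \<and> (\<forall>n. Q n \<and> R n \<longrightarrow> False)"
      by (rule eventually_inf[THEN iffD1])
    then obtain Q R where Q: "eventually Q F" and R: "eventually R (strictly_above G f)"
      and QR: "\<And>n. Q n \<Longrightarrow> R n \<Longrightarrow> False"
      by blast
    obtain \<T> where \<T>: "\<T> \<in> Fpow \<S>" "\<forall>n\<in>\<Inter>\<T>. Q n"
      using Q unfolding F_def eventually_generated by blast
    have "\<exists>C\<subseteq>G. finite C \<and> eventually R (INF g\<in>C. principal {n. g n < f n})"
      using R unfolding strictly_above_def by (rule eventually_INF[THEN iffD1])
    then obtain C where C: "C \<subseteq> G" "finite C" "eventually R (INF g\<in>C. principal {n. g n < f n})"
      by blast
    have R': "\<forall>n. (\<forall>g\<in>C. g n < f n) \<longrightarrow> R n"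
      using C(3) INF_principal_finite[OF C(2), of "\<lambda>g. {n. g n < f n}"]
      by (simp add: eventually_principal)
    have "f \<in> D (\<T>, C)"
      using \<T>(1) C by (intro f) (auto simp: Fpow_def)
    then obtain n where "n \<in> \<Inter>\<T>" "\<forall>g\<in>C. g n < f n"
      by (auto simp: D_def)
    then show False
      using \<T>(2) QR R' by blast
  qed
  then show ?thesis
    using \<open>f \<in> K0\<close> unfolding F_def K0_def by blast
qed

section \<open>Ultrafilters and cofinalities\<close>

text \<open>
  By Zorn's lemma: an ultrafilter is a minimal proper filter in the order of filters used here.
\<close>

lemma ultrafilter_extension:
  assumes "proper_nonprincipal F"
  obtains U where "ultrafilter U" "U \<le> F"
proof -
  define \<A> where "\<A> = {G. G \<noteq> bot \<and> G \<le> F}"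
  have "\<exists>U\<in>\<A>. \<forall>G\<in>\<A>. G \<le> U \<longrightarrow> G = U"
  proof (rule predicate_Zorn)
    show "partial_order_on \<A> (relation_of (\<lambda>G H. H \<le> G) \<A>)"
      by (rule partial_order_on_relation_ofI) auto
  next
    fix \<C> assume \<C>: "\<C> \<in> Chains (relation_of (\<lambda>G H. H \<le> G) \<A>)"
    show "\<exists>u\<in>\<A>. \<forall>G\<in>\<C>. u \<le> G"
    proof (cases "\<C> = {}")
      case True
      then show ?thesis
        using assms by (auto simp: \<A>_def proper_nonprincipal_def)
    next
      case False
      have sub: "\<C> \<subseteq> \<A>" and lin: "\<And>G H. G \<in> \<C> \<Longrightarrow> H \<in> \<C> \<Longrightarrow> H \<le> G \<or> G \<le> H"
        using \<C> by (auto simp: Chains_def relation_of_def)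
      have "eventually (\<lambda>_. False) (INF G\<in>\<C>. G) \<longleftrightarrow> (\<exists>G\<in>\<C>. eventually (\<lambda>_. False) G)"
      proof (rule eventually_INF_base)
        fix G H assume "G \<in> \<C>" "H \<in> \<C>"
        then show "\<exists>E\<in>\<C>. E \<le> inf G H"
          using lin[of G H] by auto
      qed (use False in blast)
      then have "Inf \<C> \<noteq> bot"
        using sub by (auto simp: trivial_limit_def \<A>_def)
      moreover have "Inf \<C> \<le> F"
        using False sub by (auto simp: \<A>_def intro: Inf_lower2)
      ultimately show ?thesis
        by (intro bexI[of _ "Inf \<C>"]) (auto simp: \<A>_def Inf_lower)
    qed
  qed
  then obtain U where U: "U \<noteq> bot" "U \<le> F"
    and maximal: "\<And>G. G \<noteq> bot \<Longrightarrow> G \<le> F \<Longrightarrow> G \<le> U \<Longrightarrow> G = U"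
    by (auto simp: \<A>_def)
  have "A \<in> filter_sets U \<or> - A \<in> filter_sets U" for A
  proof (cases "inf U (principal A) = bot")
    case True
    then have "eventually (\<lambda>x. x \<in> - A) U"
      by (simp add: trivial_limit_def eventually_inf_principal)
    then show ?thesis by (simp add: filter_sets_def)
  next
    case False
    then have "inf U (principal A) = U"
      using U(2) by (intro maximal) (auto intro: le_infI1)
    then have "U \<le> principal A"
      by (metis inf.cobounded2)
    then show ?thesis by (simp add: filter_sets_def le_principal)
  qed
  moreover have "proper_nonprincipal U"
    using U assms by (auto simp: proper_nonprincipal_def)
  ultimately show ?thesis
    using U(2) by (intro that) (auto simp: ultrafilter_def)
qed

lemma ultrafilter_eventually_bex:
  assumes "ultrafilter U" "finite C" "eventually (\<lambda>n. \<exists>g\<in>C. P g n) U"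
  shows "\<exists>g\<in>C. eventually (P g) U"
proof (rule ccontr)
  assume neg: "\<not> (\<exists>g\<in>C. eventually (P g) U)"
  have "eventually (\<lambda>n. \<not> P g n) U" if g: "g \<in> C" for g
  proof -
    have "{n. P g n} \<notin> filter_sets U"
      using neg g by (simp add: filter_sets_def)
    then have "- {n. P g n} \<in> filter_sets U"
      using assms(1) by (auto simp: ultrafilter_def)
    then show ?thesis by (simp add: filter_sets_def)
  qed
  then have "eventually (\<lambda>n. \<forall>g\<in>C. \<not> P g n) U"
    using assms(2) by (intro eventually_ball_finite) auto
  with assms(3) have "eventually (\<lambda>n. False) U"
    by eventually_elim blast
  then show False
    using assms(1) by (simp add: ultrafilter_def proper_nonprincipal_def trivial_limit_def)
qed

lemma cof_mod_le:
  assumes "D \<subseteq> K" "\<And>f. f \<in> K \<Longrightarrow> \<exists>g\<in>D. eventually (\<lambda>n. f n \<le> g n) U"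
  shows "cof_mod K U \<le>o |D|"
proof -
  have *: "D \<in> {D. D \<subseteq> K \<and> (\<forall>f\<in>K. \<exists>g\<in>D. eventually (\<lambda>n. f n \<le> g n) U)}"
    using assms by blast
  show ?thesis
    unfolding cof_mod_def by (rule least_card(2)[OF _ *]) (use * in blast)
qed

lemma cof_mod_attained:
  obtains D where "D \<subseteq> K" "\<And>f. f \<in> K \<Longrightarrow> \<exists>g\<in>D. eventually (\<lambda>n. f n \<le> g n) U"
    "cof_mod K U = |D|"
proof -
  have "K \<in> {D. D \<subseteq> K \<and> (\<forall>f\<in>K. \<exists>g\<in>D. eventually (\<lambda>n. f n \<le> g n) U)}"
    by (auto intro: always_eventually)
  then have "{D. D \<subseteq> K \<and> (\<forall>f\<in>K. \<exists>g\<in>D. eventually (\<lambda>n. f n \<le> g n) U)} \<noteq> {}"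
    by blast
  from least_card(1)[OF this] show ?thesis
    using that unfolding cof_mod_def by blast
qed

lemma countably_dominated_cof_mod:
  assumes "ultrafilter U" "countably_dominated K U K"
  shows "cof_mod K U \<le>o natLeq"
proof -
  obtain C where C: "C \<subseteq> K" "countable C"
    and dom: "\<forall>f\<in>K. \<exists>C0\<subseteq>C. finite C0 \<and> eventually (\<lambda>n. \<exists>g\<in>C0. f n \<le> g n) U"
    using assms(2) unfolding countably_dominated_def by auto
  have "cof_mod K U \<le>o |C|"
  proof (rule cof_mod_le)
    show "C \<subseteq> K" by (rule C(1))
    fix f assume "f \<in> K"
    then obtain C0 where "C0 \<subseteq> C" "finite C0" "eventually (\<lambda>n. \<exists>g\<in>C0. f n \<le> g n) U"
      using dom by blast
    then show "\<exists>g\<in>C. eventually (\<lambda>n. f n \<le> g n) U"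
      using ultrafilter_eventually_bex[OF assms(1), of C0 "\<lambda>g n. f n \<le> g n"] by blast
  qed
  moreover have "|C| \<le>o natLeq"
  proof -
    obtain e :: "(nat \<Rightarrow> nat) \<Rightarrow> nat" where "inj_on e C"
      using C(2) by (auto simp: countable_def)
    then have "|C| \<le>o |UNIV :: nat set|"
      using card_of_ordLeq by blast
    then show ?thesis
      using card_of_nat by (rule ordLeq_ordIso_trans)
  qed
  ultimately show ?thesis by (rule ordLeq_transitive)
qed

section \<open>A well-order of the Baire space of length continuum\<close>

definition fun_order :: "(nat \<Rightarrow> nat) rel" where
  "fun_order = |UNIV|"

lemma Card_order_fun_order: "Card_order fun_order"
  by (simp add: fun_order_def card_of_Card_order)

lemma Field_fun_order: "Field fun_order = UNIV"
  by (simp add: fun_order_def Field_card_of)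

lemma well_order_fun_order: "well_order_on UNIV fun_order"
  using card_of_Well_order[of "UNIV :: (nat \<Rightarrow> nat) set"] by (simp add: fun_order_def Field_card_of)

lemma linear_order_fun_order: "linear_order_on UNIV fun_order"
  using well_order_fun_order by (simp add: well_order_on_def)

lemma fun_order_total: "(\<alpha>, \<beta>) \<in> fun_order \<or> \<beta> \<in> underS fun_order \<alpha>"
  using linear_order_fun_order
  by (cases "\<alpha> = \<beta>") (auto simp: order_on_defs refl_on_def total_on_def underS_def)

lemma fun_order_trans_underS:
  "(\<alpha>, \<beta>) \<in> fun_order \<Longrightarrow> \<beta> \<in> underS fun_order \<gamma> \<Longrightarrow> \<alpha> \<in> underS fun_order \<gamma>"
  using linear_order_fun_order
  by (auto simp: order_on_defs underS_def dest: transD antisymD)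

lemma card_of_underS_fun_order: "|underS fun_order \<alpha>| <o continuum"
proof -
  have "|underS fun_order \<alpha>| <o fun_order"
    by (intro card_of_underS Card_order_fun_order) (simp add: Field_fun_order)
  then show ?thesis
    using card_of_functions_le_continuum unfolding fun_order_def by (rule ordLess_ordLeq_trans)
qed

text \<open>
  Initial segments of the well-order have fewer elements than \<open>T\<close>, so \<open>T\<close> is not contained in one.
\<close>

lemma unbounded_of_full_card:
  assumes "|UNIV :: (nat \<Rightarrow> nat) set| \<le>o |T|"
  obtains \<alpha> where "\<alpha> \<in> T" "\<gamma> \<in> underS fun_order \<alpha>"
proof -
  have inf: "infinite (UNIV :: (nat \<Rightarrow> nat) set)"
    by (metis finite_fun_UNIVD2 infinite_UNIV_nat)
  have "|underS fun_order \<gamma>| <o |UNIV :: (nat \<Rightarrow> nat) set|"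
    using card_of_underS[OF Card_order_fun_order, of \<gamma>]
    by (simp add: Field_fun_order) (simp add: fun_order_def)
  then have "|{\<gamma>} \<union> underS fun_order \<gamma>| <o |UNIV :: (nat \<Rightarrow> nat) set|"
    by (rule card_of_Un_singl_ordLess_infinite1[OF inf])
  then have "\<not> T \<subseteq> {\<gamma>} \<union> underS fun_order \<gamma>"
    using assms by (meson card_of_mono1 not_ordLess_ordLeq ordLeq_transitive)
  then obtain \<alpha> where "\<alpha> \<in> T" "\<alpha> \<noteq> \<gamma>" "\<alpha> \<notin> underS fun_order \<gamma>" by blast
  then have "\<gamma> \<in> underS fun_order \<alpha>"
    using fun_order_total[of \<gamma> \<alpha>] by (auto simp: underS_def)
  then show ?thesis using that \<open>\<alpha> \<in> T\<close> by blast
qed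

text \<open>
  Every closed set is listed as often as there are functions, so that it is listed at arbitrarily
  late stages. The even arguments of \<open>\<alpha>\<close> describe the complement as a union of basic open sets; the
  odd arguments are free.
\<close>

lemma closed_set_enumeration:
  obtains target :: "(nat \<Rightarrow> nat) \<Rightarrow> (nat \<Rightarrow> nat) set"
  where "\<And>\<alpha>. closed (target \<alpha>)"
    and "\<And>K. closed K \<Longrightarrow> |UNIV :: (nat \<Rightarrow> nat) set| \<le>o |{\<alpha>. target \<alpha> = K}|"
proof -
  obtain \<B> :: "(nat \<Rightarrow> nat) set set" where \<B>: "countable \<B>" "topological_basis \<B>"
    using ex_countable_basis by blast
  have "\<B> \<noteq> {}"
    using topological_basisE[OF \<B>(2) open_UNIV] by blast
  define b where "b = from_nat_into \<B>"
  have b: "range b = \<B>"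
    unfolding b_def using \<open>\<B> \<noteq> {}\<close> \<B>(1) by (rule range_from_nat_into)
  have open_b: "open (b n)" for n
    using topological_basis_open[OF \<B>(2)] b by blast
  define target where "target \<alpha> = - (\<Union>n\<in>{n. \<alpha> (2 * n) = (0::nat)}. b n)" for \<alpha>
  show ?thesis
  proof
    show "closed (target \<alpha>)" for \<alpha>
      unfolding target_def using open_b by (intro closed_Compl open_UN) auto
    fix K :: "(nat \<Rightarrow> nat) set"
    assume "closed K"
    define code where
      "code \<gamma> k = (if even k then if b (k div 2) \<subseteq> - K then 0 else 1 else \<gamma> (k div 2))" for \<gamma> :: "nat \<Rightarrow> nat" and k
    have "inj code"
    proof (rule injI)
      fix \<gamma> \<delta> assume "code \<gamma> = code \<delta>"
      then have "code \<gamma> (2 * k + 1) = code \<delta> (2 * k + 1)" for k by simp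
      then show "\<gamma> = \<delta>" by (auto simp: code_def)
    qed
    moreover have "target (code \<gamma>) = K" for \<gamma>
    proof -
      have "x \<in> (\<Union>n\<in>{n. b n \<subseteq> - K}. b n)" if x: "x \<in> - K" for x
      proof -
        obtain B where "B \<in> \<B>" "x \<in> B" "B \<subseteq> - K"
          using topological_basisE[OF \<B>(2) _ x] \<open>closed K\<close> by blast
        then show ?thesis using b by blast
      qed
      then have "(\<Union>n\<in>{n. b n \<subseteq> - K}. b n) = - K" by blast
      moreover have "{n. code \<gamma> (2 * n) = 0} = {n. b n \<subseteq> - K}"
        by (auto simp: code_def)
      ultimately show ?thesis by (simp add: target_def)
    qed
    ultimately show "|UNIV :: (nat \<Rightarrow> nat) set| \<le>o |{\<alpha>. target \<alpha> = K}|"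
      by (intro card_of_ordLeq[THEN iffD1] exI[of _ code]) auto
  qed
qed

section \<open>The recursion\<close>

text \<open>
  The recursion stays proper at limits. An infimum of filters is improper only if a finite part of
  it is, and finitely many stages are all covered by the last one of them.
\<close>

lemma inf_INF_not_bot:
  fixes r :: "'i rel" and H :: "'i \<Rightarrow> 'a filter"
  assumes r: "linear_order_on UNIV r" and "F \<noteq> bot"
    and step: "\<And>\<beta>. \<beta> \<in> B \<Longrightarrow> inf (inf F (INF \<gamma>\<in>underS r \<beta>. H \<gamma>)) (H \<beta>) \<noteq> bot"
  shows "inf F (INF \<beta>\<in>B. H \<beta>) \<noteq> bot"
proof
  have finite_max: "\<exists>m\<in>X. \<forall>x\<in>X. (x, m) \<in> r" if "finite X" "X \<noteq> {}" for X
    using that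
  proof (induction rule: finite_ne_induct)
    case (singleton x)
    then show ?case using r by (auto simp: order_on_defs refl_on_def)
  next
    case (insert x X)
    then obtain m where m: "m \<in> X" "\<forall>y\<in>X. (y, m) \<in> r" by blast
    have refl: "(x, x) \<in> r" and lin: "(x, m) \<in> r \<or> (m, x) \<in> r"
      using r by (cases "x = m"; auto simp: order_on_defs refl_on_def total_on_def)+
    have trans: "trans r"
      using r by (simp add: order_on_defs)
    from lin show ?case
    proof
      assume "(x, m) \<in> r"
      with m show ?thesis by blast
    next
      assume "(m, x) \<in> r"
      then have "\<forall>y\<in>insert x X. (y, x) \<in> r"
        using m(2) refl transD[OF trans] by blast
      then show ?thesis by blast
    qed
  qed
  assume "inf F (INF \<beta>\<in>B. H \<beta>) = bot"
  then have "eventually (\<lambda>_. False) (inf F (INF \<beta>\<in>B. H \<beta>))" by simp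
  then have "\<exists>Q R. eventually Q F \<and> eventually R (INF \<beta>\<in>B. H \<beta>) \<and> (\<forall>n. Q n \<and> R n \<longrightarrow> False)"
    by (rule eventually_inf[THEN iffD1])
  then obtain Q R where Q: "eventually Q F" and R: "eventually R (INF \<beta>\<in>B. H \<beta>)"
    and QR: "\<forall>n. Q n \<and> R n \<longrightarrow> False" by blast
  from R have "\<exists>X\<subseteq>B. finite X \<and> eventually R (INF \<beta>\<in>X. H \<beta>)"
    by (rule eventually_INF[THEN iffD1])
  then obtain X where X: "X \<subseteq> B" "finite X" "eventually R (INF \<beta>\<in>X. H \<beta>)" by blast
  have "eventually (\<lambda>_. False) (inf F (INF \<beta>\<in>X. H \<beta>))"
    using Q X(3) QR unfolding eventually_inf by blast
  then have bot: "inf F (INF \<beta>\<in>X. H \<beta>) = bot"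
    by (simp add: trivial_limit_def)
  then have "X \<noteq> {}"
    using \<open>F \<noteq> bot\<close> by auto
  then obtain m where m: "m \<in> X" "\<forall>x\<in>X. (x, m) \<in> r"
    using finite_max X(2) by blast
  have "inf (INF \<gamma>\<in>underS r m. H \<gamma>) (H m) \<le> H x" if "x \<in> X" for x
  proof (cases "x = m")
    case False
    then have "x \<in> underS r m" using m(2) \<open>x \<in> X\<close> by (auto simp: underS_def)
    then show ?thesis by (intro le_infI1 INF_lower)
  qed simp
  then have "inf (INF \<gamma>\<in>underS r m. H \<gamma>) (H m) \<le> (INF x\<in>X. H x)"
    by (rule INF_greatest)
  then have "inf (inf F (INF \<gamma>\<in>underS r m. H \<gamma>)) (H m) \<le> inf F (INF x\<in>X. H x)"
    by (simp add: inf.assoc le_infI2)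
  then have "inf (inf F (INF \<gamma>\<in>underS r m. H \<gamma>)) (H m) = bot"
    using bot by (simp add: bot_unique)
  then show False
    using step m(1) X(1) by blast
qed

text \<open>
  The filter reached before stage \<open>\<alpha>\<close>. At stage \<open>\<beta>\<close> the chosen function \<open>a \<beta>\<close> is put strictly above
  all functions of \<open>target \<beta>\<close> that precede \<open>\<beta>\<close>: the index \<open>\<beta>\<close> of a stage is itself a function,
  and the order of the stages is the well-order of \<open>\<omega>\<^sup>\<omega>\<close>.
\<close>

definition stage ::
  "nat filter \<Rightarrow> ((nat \<Rightarrow> nat) \<Rightarrow> (nat \<Rightarrow> nat) set) \<Rightarrow> ((nat \<Rightarrow> nat) \<Rightarrow> nat \<Rightarrow> nat) \<Rightarrow> (nat \<Rightarrow> nat) \<Rightarrow> nat filter"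
  where "stage F target a \<alpha> =
    inf F (INF \<beta>\<in>underS fun_order \<alpha>. strictly_above (underS fun_order \<beta> \<inter> target \<beta>) (a \<beta>))"

text \<open>
  Before stage \<open>\<alpha>\<close> at most one generator has been added for each pair of functions preceding \<open>\<alpha>\<close>.
\<close>

lemma stage_generated:
  assumes F: "F = (INF A\<in>\<S>. principal A)" "|\<S>| <o continuum"
  obtains \<S>' where "stage F target a \<alpha> = (INF A\<in>\<S>'. principal A)" "|\<S>'| <o continuum"
proof -
  let ?I = "SIGMA \<beta>:underS fun_order \<alpha>. underS fun_order \<beta> \<inter> target \<beta>"
  let ?new = "(\<lambda>(\<beta>, g). {n. g n < a \<beta> n}) ` ?I"
  have "?I \<subseteq> underS fun_order \<alpha> \<times> underS fun_order \<alpha>"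
  proof
    fix p assume "p \<in> ?I"
    then have "fst p \<in> underS fun_order \<alpha>" "snd p \<in> underS fun_order (fst p)" by auto
    moreover from this(2) have "(snd p, fst p) \<in> fun_order" by (simp add: underS_def)
    ultimately show "p \<in> underS fun_order \<alpha> \<times> underS fun_order \<alpha>"
      using fun_order_trans_underS by (metis mem_Times_iff)
  qed
  then have "|?I| \<le>o |underS fun_order \<alpha> \<times> underS fun_order \<alpha>|"
    by (rule card_of_mono1)
  moreover have "|underS fun_order \<alpha> \<times> underS fun_order \<alpha>| <o continuum"
    by (intro card_of_Times_ordLess_infinite_Field infinite_Field_continuum
        Card_order_continuum card_of_underS_fun_order)
  ultimately have "|?I| <o continuum"
    by (rule ordLeq_ordLess_trans)
  then have "|?new| <o continuum"
    by (rule ordLeq_ordLess_trans[OF card_of_image])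
  then have "|\<S> \<union> ?new| <o continuum"
    by (intro card_of_Un_ordLess_infinite_Field infinite_Field_continuum Card_order_continuum F(2))
  moreover have "stage F target a \<alpha> = (INF A\<in>\<S> \<union> ?new. principal A)"
  proof -
    have "(INF A\<in>?new. principal A) =
        (INF \<beta>\<in>underS fun_order \<alpha>. strictly_above (underS fun_order \<beta> \<inter> target \<beta>) (a \<beta>))"
      unfolding strictly_above_def
    proof (rule antisym)
      show "(INF A\<in>?new. principal A) \<le>
          (INF \<beta>\<in>underS fun_order \<alpha>. INF g\<in>underS fun_order \<beta> \<inter> target \<beta>. principal {n. g n < a \<beta> n})"
        by (intro INF_greatest INF_lower) force
      show "(INF \<beta>\<in>underS fun_order \<alpha>. INF g\<in>underS fun_order \<beta> \<inter> target \<beta>. principal {n. g n < a \<beta> n})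
          \<le> (INF A\<in>?new. principal A)"
        by (intro INF_greatest) (auto intro: INF_lower2)
    qed
    then show ?thesis
      unfolding stage_def F(1) by (simp only: INF_union)
  qed
  ultimately show ?thesis using that by blast
qed

text \<open>
  When \<open>target \<alpha>\<close> is countably dominated, no bound inside it can be expected, but a bound in
  \<open>\<omega>\<^sup>\<omega>\<close> always exists. Choosing such a bound keeps the recursion uniform.
\<close>

lemma stage_sequence:
  assumes cov: "cov_meager =o continuum" and F: "proper_nonprincipal F"
    and char: "filter_character F <o continuum"
    and target: "\<And>\<alpha>. closed (target \<alpha>)"
  obtains a where
    "\<And>\<alpha>. inf (stage F target a \<alpha>) (strictly_above (underS fun_order \<alpha> \<inter> target \<alpha>) (a \<alpha>)) \<noteq> bot"
    "\<And>\<alpha>. \<not> countably_dominated (underS fun_order \<alpha> \<inter> target \<alpha>) (stage F target a \<alpha>) (target \<alpha>) \<Longrightarrow> a \<alpha> \<in> target \<alpha>"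
proof -
  obtain \<S> where \<S>: "F = (INF A\<in>\<S>. principal A)" "|\<S>| <o continuum"
    using generated_by_few_sets[OF char] by blast
  define G where "G \<alpha> = underS fun_order \<alpha> \<inter> target \<alpha>" for \<alpha>
  define good where "good a \<alpha> f \<longleftrightarrow> inf (stage F target a \<alpha>) (strictly_above (G \<alpha>) f) \<noteq> bot \<and>
      (\<not> countably_dominated (G \<alpha>) (stage F target a \<alpha>) (target \<alpha>) \<longrightarrow> f \<in> target \<alpha>)" for a \<alpha> f
  have "\<exists>a. \<forall>\<alpha>. good a \<alpha> (a \<alpha>)"
  proof (rule dependent_wf_choice)
    show "wf (fun_order - Id)"
      using well_order_fun_order by (simp add: well_order_on_def)
  next
    fix a a' :: "(nat \<Rightarrow> nat) \<Rightarrow> nat \<Rightarrow> nat" and \<alpha> f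
    assume "\<And>\<beta>. (\<beta>, \<alpha>) \<in> fun_order - Id \<Longrightarrow> a \<beta> = a' \<beta>"
    then have "stage F target a \<alpha> = stage F target a' \<alpha>"
      unfolding stage_def by (intro arg_cong2[where f = inf] INF_cong refl) (simp_all add: underS_def)
    then show "good a \<alpha> f = good a' \<alpha> f"
      by (simp add: good_def)
  next
    fix \<alpha> and a :: "(nat \<Rightarrow> nat) \<Rightarrow> nat \<Rightarrow> nat"
    assume prev: "\<And>\<beta>. (\<beta>, \<alpha>) \<in> fun_order - Id \<Longrightarrow> good a \<beta> (a \<beta>)"
    have "stage F target a \<alpha> \<noteq> bot"
      unfolding stage_def
    proof (rule inf_INF_not_bot[OF linear_order_fun_order])
      show "F \<noteq> bot" using F by (simp add: proper_nonprincipal_def)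
      fix \<beta> assume "\<beta> \<in> underS fun_order \<alpha>"
      then have "good a \<beta> (a \<beta>)" using prev by (simp add: underS_def)
      then show "inf (inf F (INF \<gamma>\<in>underS fun_order \<beta>. strictly_above (underS fun_order \<gamma> \<inter> target \<gamma>) (a \<gamma>)))
          (strictly_above (underS fun_order \<beta> \<inter> target \<beta>) (a \<beta>)) \<noteq> bot"
        by (simp add: good_def stage_def G_def)
    qed
    then have proper: "proper_nonprincipal (stage F target a \<alpha>)"
      using F unfolding proper_nonprincipal_def stage_def by (auto intro: le_infI1)
    obtain \<S>' where \<S>': "stage F target a \<alpha> = (INF A\<in>\<S>'. principal A)" "|\<S>'| <o continuum"
      using stage_generated[OF \<S>] by blast
    have G: "|G \<alpha>| <o continuum"
      unfolding G_def by (rule ordLeq_ordLess_trans[OF card_of_mono1 card_of_underS_fun_order]) blast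
    show "\<exists>f. good a \<alpha> f"
    proof (cases "countably_dominated (G \<alpha>) (stage F target a \<alpha>) (target \<alpha>)")
      case True
      have "\<exists>f\<in>UNIV. inf (INF A\<in>\<S>'. principal A) (strictly_above (G \<alpha>) f) \<noteq> bot"
        using not_countably_dominated_UNIV[OF proper]
        by (intro extension_strictly_above[OF cov \<S>'(2) G]) (simp_all add: \<S>'(1))
      with True show ?thesis by (auto simp: good_def \<S>'(1))
    next
      case False
      then have "\<exists>f\<in>target \<alpha>. inf (INF A\<in>\<S>'. principal A) (strictly_above (G \<alpha>) f) \<noteq> bot"
        by (intro extension_strictly_above[OF cov \<S>'(2) G target]) (simp add: \<S>'(1))
      then show ?thesis by (auto simp: good_def \<S>'(1))
    qed
  qed
  then show ?thesis
    using that unfolding good_def G_def by blast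
qed

text \<open>
  Given \<open>K\<close> and \<open>\<gamma>\<close>, pick a stage \<open>\<alpha>\<close> later than \<open>\<gamma>\<close> whose target is \<open>K\<close>. Since \<open>U\<close> extends the
  filter of that stage, a set \<open>K\<close> that is not countably dominated modulo \<open>U\<close> was not dominated
  there either, so that \<open>a \<alpha>\<close> was chosen in \<open>K\<close>.
\<close>

lemma ultrafilter_with_scales:
  assumes "cov_meager =o continuum" and F: "proper_nonprincipal F"
    and "filter_character F <o continuum"
  obtains U where "ultrafilter U" "U \<le> F"
    and "\<And>K \<gamma>. closed K \<Longrightarrow> \<not> countably_dominated K U K \<Longrightarrow>
      \<exists>f\<in>K. \<forall>g\<in>K. (g, \<gamma>) \<in> fun_order \<longrightarrow> eventually (\<lambda>n. g n < f n) U"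
proof -
  obtain target :: "(nat \<Rightarrow> nat) \<Rightarrow> (nat \<Rightarrow> nat) set"
    where closed_target: "\<And>\<alpha>. closed (target \<alpha>)"
      and full: "\<And>K. closed K \<Longrightarrow> |UNIV :: (nat \<Rightarrow> nat) set| \<le>o |{\<alpha>. target \<alpha> = K}|"
    by (rule closed_set_enumeration) (rule that)
  obtain a where ne: "\<And>\<alpha>. inf (stage F target a \<alpha>) (strictly_above (underS fun_order \<alpha> \<inter> target \<alpha>) (a \<alpha>)) \<noteq> bot"
    and a: "\<And>\<alpha>. \<not> countably_dominated (underS fun_order \<alpha> \<inter> target \<alpha>) (stage F target a \<alpha>) (target \<alpha>) \<Longrightarrow> a \<alpha> \<in> target \<alpha>"
    by (rule stage_sequence[OF assms closed_target]) (rule that)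
  define L where "L = inf F (INF \<alpha>. strictly_above (underS fun_order \<alpha> \<inter> target \<alpha>) (a \<alpha>))"
  have "L \<noteq> bot"
    unfolding L_def
    by (rule inf_INF_not_bot[OF linear_order_fun_order])
      (use F ne in \<open>simp_all add: proper_nonprincipal_def stage_def\<close>)
  moreover have "L \<le> F" by (simp add: L_def)
  ultimately have "proper_nonprincipal L"
    using F by (auto simp: proper_nonprincipal_def)
  then obtain U where U: "ultrafilter U" "U \<le> L"
    using ultrafilter_extension by blast
  have U_le_bound: "U \<le> strictly_above (underS fun_order \<alpha> \<inter> target \<alpha>) (a \<alpha>)" for \<alpha>
    using U(2) unfolding L_def by (rule order_trans) (intro le_infI2 INF_lower, simp)
  have U_stage: "U \<le> stage F target a \<alpha>" for \<alpha>
    using U(2) \<open>L \<le> F\<close> U_le_bound unfolding stage_def by (intro le_infI INF_greatest) auto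
  show ?thesis
  proof
    show "ultrafilter U" by (rule U(1))
    show "U \<le> F" using U(2) \<open>L \<le> F\<close> by (rule order_trans)
    fix K \<gamma> assume K: "closed K" "\<not> countably_dominated K U K"
    obtain \<alpha> where \<alpha>: "target \<alpha> = K" "\<gamma> \<in> underS fun_order \<alpha>"
      using unbounded_of_full_card[OF full[OF K(1)], of \<gamma>] by blast
    have "a \<alpha> \<in> K"
      using a[of \<alpha>] K(2) countably_dominated_mono[OF _ _ U_stage, of _ \<alpha> K K K] unfolding \<alpha>(1) by blast
    moreover have "eventually (\<lambda>n. g n < a \<alpha> n) U" if "g \<in> K" "(g, \<gamma>) \<in> fun_order" for g
    proof -
      have "g \<in> underS fun_order \<alpha> \<inter> target \<alpha>"
        using that \<alpha> fun_order_trans_underS by blast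
      then have "strictly_above (underS fun_order \<alpha> \<inter> target \<alpha>) (a \<alpha>) \<le> principal {n. g n < a \<alpha> n}"
        unfolding strictly_above_def by (rule INF_lower)
      with U_le_bound have "U \<le> principal {n. g n < a \<alpha> n}"
        by (rule order_trans)
      then show ?thesis by (simp add: le_principal)
    qed
    ultimately show "\<exists>f\<in>K. \<forall>g\<in>K. (g, \<gamma>) \<in> fun_order \<longrightarrow> eventually (\<lambda>n. g n < f n) U"
      by blast
  qed
qed

section \<open>The Michael ultrafilter\<close>

lemma compact_imp_closed_fun:
  fixes K :: "('a \<Rightarrow> 'b::t2_space) set"
  assumes "compact K"
  shows "closed K"
proof -
  have "Hausdorff_space (euclidean :: 'b topology)"
    unfolding Hausdorff_space_def disjnt_def by (simp, metis hausdorff)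
  then have "Hausdorff_space (product_topology (\<lambda>_. euclidean :: 'b topology) (UNIV :: 'a set))"
    by (simp add: Hausdorff_space_product_topology)
  then have "Hausdorff_space (euclidean :: ('a \<Rightarrow> 'b) topology)"
    by (simp add: euclidean_product_topology)
  moreover have "compactin euclidean K"
    using assms by simp
  ultimately show ?thesis
    using compactin_imp_closedin by (metis closed_closedin)
qed

theorem theorem1p5:
  fixes F :: "nat filter"
  assumes "cov_meager =o continuum"
    and "proper_nonprincipal F"
    and "filter_character F <o continuum"
  shows "\<exists>U. michael_ultrafilter U \<and> U \<le> F"
proof -
  obtain U where U: "ultrafilter U" "U \<le> F"
    and scale: "\<And>K \<gamma>. closed K \<Longrightarrow> \<not> countably_dominated K U K \<Longrightarrow>
      \<exists>f\<in>K. \<forall>g\<in>K. (g, \<gamma>) \<in> fun_order \<longrightarrow> eventually (\<lambda>n. g n < f n) U"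
    by (rule ultrafilter_with_scales[OF assms]) (rule that)
  have proper: "proper_nonprincipal U"
    using U(1) by (simp add: ultrafilter_def)
  have "\<exists>h. \<forall>g. (g, \<gamma>) \<in> fun_order \<longrightarrow> eventually (\<lambda>n. g n < h n) U" for \<gamma>
    using scale[OF closed_UNIV not_countably_dominated_UNIV[OF proper], of \<gamma>] by simp
  then obtain h where h: "\<And>\<gamma> g. (g, \<gamma>) \<in> fun_order \<Longrightarrow> eventually (\<lambda>n. g n < h \<gamma> n) U"
    by metis
  have "cof_mod UNIV U \<le>o cof_mod K U" if K: "compact K" and uncountable: "natLeq <o cof_mod K U" for K
  proof -
    have undominated: "\<not> countably_dominated K U K"
      using uncountable countably_dominated_cof_mod[OF U(1)] not_ordLess_ordLeq by blast
    obtain D where D: "D \<subseteq> K" "\<And>f. f \<in> K \<Longrightarrow> \<exists>d\<in>D. eventually (\<lambda>n. f n \<le> d n) U"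
      and card: "cof_mod K U = |D|"
      using cof_mod_attained[of K U] by blast
    have "cof_mod UNIV U \<le>o |h ` D|"
    proof (rule cof_mod_le)
      fix g :: "nat \<Rightarrow> nat"
      obtain f where "f \<in> K" and f: "\<forall>d\<in>K. (d, g) \<in> fun_order \<longrightarrow> eventually (\<lambda>n. d n < f n) U"
        using scale[OF compact_imp_closed_fun[OF K] undominated, of g] by blast
      obtain d where "d \<in> D" and d: "eventually (\<lambda>n. f n \<le> d n) U"
        using D(2)[OF \<open>f \<in> K\<close>] by blast
      \<comment> \<open>Otherwise \<open>d\<close> would be one of the functions that \<open>f\<close> exceeds strictly.\<close>
      have "(d, g) \<notin> fun_order"
      proof
        assume "(d, g) \<in> fun_order"
        then have "eventually (\<lambda>n. d n < f n) U"
          using f \<open>d \<in> D\<close> D(1) by blast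
        with d have "eventually (\<lambda>n. False) U"
          by eventually_elim simp
        then show False
          using proper by (simp add: proper_nonprincipal_def trivial_limit_def)
      qed
      then have "(g, d) \<in> fun_order"
        using fun_order_total[of d g] by (simp add: underS_def)
      then have "eventually (\<lambda>n. g n < h d n) U"
        by (rule h)
      then have "eventually (\<lambda>n. g n \<le> h d n) U"
        by eventually_elim simp
      then show "\<exists>e\<in>h ` D. eventually (\<lambda>n. g n \<le> e n) U"
        using \<open>d \<in> D\<close> by blast
    qed simp
    also have "|h ` D| \<le>o |D|"
      by (rule card_of_image)
    finally show ?thesis
      by (simp add: card)
  qed
  then show ?thesis
    using U by (auto simp: michael_ultrafilter_def)
qed

end
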